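(* Let $k>1$ be an integer. For any word $w$, $N_k(w) \le \frac{|w|-|\mathrm{Alph}(w)|}{k-1}$. Consequently, for any integer $n\ge 1$, $N(n,k)\le \frac{n-1}{k-1}$.
   Context: Words are finite sequences over an arbitrary alphabet; $|w|$ is the length of $w$ and $\mathrm{Alph}(w)$ is the set of letters occurring in $w$. A $k$-power is a word of the form $x^k$ with $x$ a nonempty word. $N_k(w)$ denotes the number of distinct factors (contiguous subwords) of $w$ that are $k$-powers, and $N(n,k)$ is the maximum of $N_k(w)$ over all words $w$ of length $n$. *)

theory Defs
  imports Complex_Main "HOL-Library.Sublist"
begin

definition is_kpower :: "nat \<Rightarrow> 'a list \<Rightarrow> bool" where
  "is_kpower k u \<longleftrightarrow> (\<exists>x. x \<noteq> [] \<and> u = concat (replicate k x))"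

definition kpower_factors :: "nat \<Rightarrow> 'a list \<Rightarrow> 'a list set" where
  "kpower_factors k w = {u. sublist u w \<and> is_kpower k u}"

definition num_kpowers :: "nat \<Rightarrow> 'a list \<Rightarrow> nat" where
  "num_kpowers k w = card (kpower_factors k w)"

text \<open>The alphabet is a type, passed as an explicit argument. There may be infinitely many words of
  length \<open>n\<close>, but the set of values is finite and nonempty (\<open>finite_num_kpowers_values\<close> and
  \<open>num_kpowers_values_nonempty\<close>), so \<open>Max\<close> is a genuine maximum. All infinite alphabets give the
  same value, and it dominates the value for every finite alphabet
  (\<open>num_kpowers_le_max_num_kpowers\<close>).\<close>

definition max_num_kpowers :: "'a itself \<Rightarrow> nat \<Rightarrow> nat \<Rightarrow> nat" where
  "max_num_kpowers A n k = Max {num_kpowers k w | w :: 'a list. length w = n}"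

lemma kpower_factors_subset: "kpower_factors k w \<subseteq> set (sublists w)"
  by (auto simp: kpower_factors_def)

lemma finite_kpower_factors: "finite (kpower_factors k w)"
  using kpower_factors_subset finite_subset by blast

lemma finite_num_kpowers_values:
  "finite {num_kpowers k w | w :: 'a list. length w = n}"
proof (rule finite_subset)
  have "num_kpowers k w \<le> length (sublists w)" for w :: "'a list"
    using card_mono[OF _ kpower_factors_subset[of k w]] card_length[of "sublists w"]
    unfolding num_kpowers_def by fastforce
  then show "{num_kpowers k w | w :: 'a list. length w = n} \<subseteq> {..Suc (n * Suc n div 2)}"
    unfolding length_sublists by blast
qed simp

lemma num_kpowers_values_nonempty:
  "{num_kpowers k w | w :: 'a list. length w = n} \<noteq> {}"
  using length_replicate[of n "undefined :: 'a"] by blast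

lemma num_kpowers_map_inj:
  assumes "inj_on f (set w)"
  shows "num_kpowers k w \<le> num_kpowers k (map f w)"
  unfolding num_kpowers_def
proof (rule card_inj_on_le[where f = "map f"])
  have sub: "kpower_factors k w \<subseteq> lists (set w)"
    by (auto simp: kpower_factors_def dest: set_mono_sublist)
  show "inj_on (map f) (kpower_factors k w)"
    using assms sub by (meson inj_on_map_lists inj_on_subset)
  show "map f ` kpower_factors k w \<subseteq> kpower_factors k (map f w)"
  proof
    fix v assume "v \<in> map f ` kpower_factors k w"
    then obtain x where x: "x \<noteq> []" "v = map f (concat (replicate k x))"
      and "sublist (concat (replicate k x)) w"
      by (auto simp: kpower_factors_def is_kpower_def)
    then have "sublist v (map f w)" by (simp add: map_mono_sublist)
    moreover have "map f x \<noteq> []" "v = concat (replicate k (map f x))"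
      using x by (simp_all add: map_concat)
    ultimately show "v \<in> kpower_factors k (map f w)"
      unfolding kpower_factors_def is_kpower_def by blast
  qed
  show "finite (kpower_factors k (map f w))" by (rule finite_kpower_factors)
qed

lemma num_kpowers_le_max_num_kpowers:
  fixes w :: "'b list"
  assumes "infinite (UNIV :: 'a set)"
  shows "num_kpowers k w \<le> max_num_kpowers TYPE('a) (length w) k"
proof -
  obtain B :: "'a set" where "finite B" "card B = card (set w)"
    using infinite_arbitrarily_large[OF assms] by blast
  then obtain f where "bij_betw f (set w) B"
    using finite_same_card_bij[of "set w" B] by auto
  then have "num_kpowers k w \<le> num_kpowers k (map f w)"
    by (intro num_kpowers_map_inj) (simp add: bij_betw_def)
  also have "\<dots> \<le> max_num_kpowers TYPE('a) (length w) k"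
    unfolding max_num_kpowers_def
    by (rule Max_ge[OF finite_num_kpowers_values]) (metis (mono_tags, lifting) length_map mem_Collect_eq)
  finally show ?thesis .
qed

end

theory Submission
  imports Defs "HOL-Library.List_Lexorder" "HOL-Library.Omega_Words_Fun"
begin

text \<open>The Rauzy graph of order \<open>m\<close> of a word \<open>w\<close> has the factors of length \<open>m\<close> as vertices and
  those of length \<open>m + 1\<close> as edges, each joining its prefix and its suffix of length \<open>m\<close>. It is
  connected, so its cyclomatic number is \<open>C(m+1) - C(m) + 1\<close>, where \<open>C\<close> is the factor complexity
  of \<open>w\<close>; summed over \<open>1 \<le> m \<le> |w|\<close> these numbers telescope to \<open>|w| - |Alph(w)|\<close>. A Lyndon word
  \<open>z\<close> with \<open>|z| \<le> m\<close> such that \<open>w\<close> contains all factors of length \<open>m + 1\<close> of \<open>zzz...\<close> gives a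
  circuit of length \<open>|z|\<close>. These circuits are independent: as Lyndon words are unbordered, the
  edge starting with \<open>z\<close> lies on no shorter circuit. Finally, if \<open>w\<close> contains \<open>c > 0\<close> conjugates
  of the power of \<open>z\<close> with exponent \<open>kj\<close>, then the circuit of \<open>z\<close> is present for at least
  \<open>(k - 1) c\<close> orders \<open>m\<close> with \<open>k(j - 1)|z| \<le> m < kj|z|\<close>, since shortening the factors of \<open>zzz...\<close> by one
  letter adds a new one among those in \<open>w\<close> until all of them occur.\<close>

section \<open>Periodic words\<close>

declare subseq_to_Suc [simp del]

lemma sublist_subsequence:
  assumes "a \<le> i" "j \<le> b"
  shows "sublist (w [i \<rightarrow> j]) (w [a \<rightarrow> b])"
proof (cases "i \<le> j")
  case True
  then have "w [i \<rightarrow> j] = drop (i - a) (take (j - a) (w [a \<rightarrow> b]))"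
    using assms by (simp add: min_def)
  then show ?thesis
    by (metis sublist_drop sublist_order.order_trans sublist_take)
qed simp

lemma butlast_subsequence:
  "i \<le> j \<Longrightarrow> butlast (w [i \<rightarrow> Suc j]) = (w [i \<rightarrow> j])"
  by (simp add: subseq_to_Suc)

lemma tl_subsequence: "tl (w [i \<rightarrow> j]) = (w [Suc i \<rightarrow> j])"
  using subsequence_drop[of "Suc 0" w i j] by (simp add: drop_Suc del: subsequence_drop)

lemma suffix_mult_period:
  assumes "suffix p w = w"
  shows "suffix (q * p) w = w"
proof (induction q)
  case (Suc q)
  have "suffix (Suc q * p) w = suffix (q * p) (suffix p w)"
    by (simp add: add.commute)
  then show ?case
    using assms Suc.IH by simp
qed simp

lemma iter_prefix_period:
  assumes "suffix p w = w" "0 < p"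
  shows "(w [0 \<rightarrow> p])\<^sup>\<omega> = w"
proof
  fix t
  have "w (t mod p) = suffix (t div p * p) w (t mod p)"
    by (simp only: suffix_mult_period[OF assms(1)])
  then show "(w [0 \<rightarrow> p])\<^sup>\<omega> t = w t"
    using assms(2) by simp
qed

lemma subsequence_iter_cong:
  assumes "z \<noteq> []" "i mod length z = j mod length z"
  shows "z\<^sup>\<omega> [i \<rightarrow> i + n] = (z\<^sup>\<omega> [j \<rightarrow> j + n])"
proof (rule nth_equalityI)
  fix t assume "t < length (z\<^sup>\<omega> [i \<rightarrow> i + n])"
  moreover have "(i + t) mod length z = (j + t) mod length z"
    using assms(2) by (rule mod_add_cong) simp
  ultimately show "z\<^sup>\<omega> [i \<rightarrow> i + n] ! t = (z\<^sup>\<omega> [j \<rightarrow> j + n]) ! t"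
    using assms(1) by simp
qed simp

lemma prefix_iter: "z \<noteq> [] \<Longrightarrow> z\<^sup>\<omega> [0 \<rightarrow> length z] = z"
  by (rule nth_equalityI) simp_all

lemma suffix_length_iter: "z \<noteq> [] \<Longrightarrow> suffix (length z) z\<^sup>\<omega> = z\<^sup>\<omega>"
  by (rule ext) simp

lemma rotate_eq_subsequence_iter:
  "z \<noteq> [] \<Longrightarrow> rotate i z = (z\<^sup>\<omega> [i \<rightarrow> i + length z])"
  by (rule nth_equalityI) (simp_all add: nth_rotate add.commute)

lemma iter_subsequence_iter:
  assumes "z \<noteq> []" "0 < n" "length z dvd n"
  shows "(z\<^sup>\<omega> [i \<rightarrow> i + n])\<^sup>\<omega> = suffix i z\<^sup>\<omega>"
proof -
  obtain q where "n = q * length z"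
    using assms(3) by (metis dvdE mult.commute)
  then have "suffix n z\<^sup>\<omega> = z\<^sup>\<omega>"
    using suffix_mult_period[OF suffix_length_iter[OF assms(1)]] by simp
  then have "suffix n (suffix i z\<^sup>\<omega>) = suffix i z\<^sup>\<omega>"
    by (metis add.commute suffix_suffix)
  then show ?thesis
    using iter_prefix_period[of n "suffix i z\<^sup>\<omega>"] assms(2) by simp
qed

lemma concat_replicate_eq_prefix_iter:
  assumes "x \<noteq> []"
  shows "concat (replicate k x) = (x\<^sup>\<omega> [0 \<rightarrow> k * length x])"
proof (induction k)
  case (Suc k)
  have "x\<^sup>\<omega> [length x \<rightarrow> length x + k * length x] = (x\<^sup>\<omega> [0 \<rightarrow> k * length x])"
    using subsequence_iter_cong[OF assms, of "length x" 0] by simp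
  then show ?case
    using Suc.IH subsequence_append[of "x\<^sup>\<omega>" "length x" "k * length x"] prefix_iter[OF assms]
    by simp
qed simp

lemma concat_replicate_subsequence_iter:
  assumes "z \<noteq> []" "0 < n" "length z dvd n"
  shows "concat (replicate k (z\<^sup>\<omega> [i \<rightarrow> i + n])) = (z\<^sup>\<omega> [i \<rightarrow> i + k * n])"
proof -
  have "z\<^sup>\<omega> [i \<rightarrow> i + n] \<noteq> []"
    using assms(2) by simp
  then show ?thesis
    by (simp add: concat_replicate_eq_prefix_iter iter_subsequence_iter[OF assms])
qed

section \<open>Primitive words and Lyndon words\<close>

definition primitive :: "'a list \<Rightarrow> bool" where
  "primitive y \<longleftrightarrow> y \<noteq> [] \<and> (\<forall>i. 0 < i \<and> i < length y \<longrightarrow> rotate i y \<noteq> y)"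

definition lyndon :: "'a::linorder list \<Rightarrow> bool" where
  "lyndon z \<longleftrightarrow> z \<noteq> [] \<and> (\<forall>i. 0 < i \<and> i < length z \<longrightarrow> z < rotate i z)"

lemma lyndon_nonempty: "lyndon z \<Longrightarrow> z \<noteq> []"
  by (simp add: lyndon_def)

lemma lyndon_less_rotate: "lyndon z \<Longrightarrow> 0 < i \<Longrightarrow> i < length z \<Longrightarrow> z < rotate i z"
  by (simp add: lyndon_def)

lemma append_less_append_left_iff:
  fixes u a b :: "'a::order list"
  shows "u @ a < u @ b \<longleftrightarrow> a < b"
  by (induction u) auto

lemma append_less_append_rightD:
  fixes u a b :: "'a::order list"
  assumes "a @ u < b @ u" "length a = length b"
  shows "a < b"
  using assms lexord_sufE[of a u b u] by (cases "a = b") (auto simp: list_less_def)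

lemma lyndon_unbordered:
  assumes "lyndon z" "z = u @ v" "z = v' @ u" "u \<noteq> []" "v \<noteq> []"
  shows False
proof -
  have same_length: "length v = length v'" and "length z = length u + length v"
    using arg_cong[OF assms(2), of length] arg_cong[OF assms(3), of length] by simp_all
  then have "0 < length u" "length u < length z" "0 < length v'" "length v' < length z"
    using assms(4,5) by auto
  then have "z < rotate (length u) z" "z < rotate (length v') z"
    by (simp_all add: lyndon_less_rotate[OF assms(1)])
  moreover have "rotate (length u) z = v @ u"
    by (simp add: assms(2) rotate_append)
  moreover have "rotate (length v') z = u @ v'"
    by (simp add: assms(3) rotate_append)
  ultimately have "v' @ u < v @ u" "u @ v < u @ v'"
    using assms(2,3) by metis+
  then have "v' < v" "v < v'"
    using append_less_append_rightD[OF _ same_length[symmetric]]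
    by (simp_all add: append_less_append_left_iff)
  then show False
    by simp
qed

lemma length_lyndon_factor_iter_le:
  assumes "lyndon z" "v \<noteq> []" and z_eq: "z = (v\<^sup>\<omega> [i \<rightarrow> i + length z])"
  shows "length z \<le> length v"
proof (rule ccontr)
  define p where "p = length v"
  define n where "n = length z"
  assume "\<not> length z \<le> length v"
  then have "0 < p" "p < n"
    using assms(2) by (simp_all add: p_def n_def)
  have "drop p z = (v\<^sup>\<omega> [i + p \<rightarrow> i + n])"
    by (subst z_eq) (simp add: n_def)
  also have "\<dots> = (v\<^sup>\<omega> [i \<rightarrow> i + (n - p)])"
    using subsequence_iter_cong[OF assms(2), of "i + p" i "n - p"] \<open>p < n\<close> by (simp add: p_def)
  also have "\<dots> = take (n - p) z"
    by (subst z_eq) (simp add: n_def)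
  finally have "drop p z = take (n - p) z" .
  show False
  proof (rule lyndon_unbordered[OF assms(1)])
    show "z = take (n - p) z @ drop (n - p) z"
      by simp
    show "z = take p z @ take (n - p) z"
      using append_take_drop_id[of p z] \<open>drop p z = take (n - p) z\<close> by simp
  qed (use \<open>0 < p\<close> \<open>p < n\<close> in \<open>auto simp: n_def\<close>)
qed

lemma lyndon_rotate_lyndon:
  assumes "lyndon z" "lyndon (rotate i z)" "i < length z"
  shows "i = 0"
proof (rule ccontr)
  assume "i \<noteq> 0"
  then have "z < rotate i z" "rotate i z < rotate (length z - i) (rotate i z)"
    using assms by (simp_all add: lyndon_less_rotate)
  then show False
    using assms(3) by (simp add: rotate_rotate)
qed

lemma lyndon_factor_iter_cases:
  assumes "lyndon z" "lyndon z'" "z' = (z\<^sup>\<omega> [i \<rightarrow> i + length z'])" "i < length z"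
  shows "length z' < length z \<or> z' = z \<and> i = 0"
proof (cases "length z' = length z")
  case True
  then have "z' = rotate i z"
    using assms(1,3) rotate_eq_subsequence_iter lyndon_nonempty by metis
  then show ?thesis
    using lyndon_rotate_lyndon[of z i] assms by auto
next
  case False
  then show ?thesis
    using length_lyndon_factor_iter_le[OF assms(2) lyndon_nonempty[OF assms(1)] assms(3)] by simp
qed

lemma ex_primitive_root:
  assumes "x \<noteq> []"
  shows "\<exists>y. primitive y \<and> length y dvd length x \<and> y\<^sup>\<omega> = x\<^sup>\<omega>"
proof -
  define period where "period q \<longleftrightarrow> 0 < q \<and> suffix q x\<^sup>\<omega> = x\<^sup>\<omega>" for q
  define p where "p = (LEAST q. period q)"
  have period_length: "period (length x)"
    using assms by (simp add: period_def suffix_length_iter)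
  then have "period p"
    unfolding p_def by (rule LeastI)
  have least: "\<not> period q" if "q < p" for q
    using that not_less_Least unfolding p_def by blast
  define y where "y = (x\<^sup>\<omega> [0 \<rightarrow> p])"
  have y_props: "y \<noteq> []" "length y = p" "y\<^sup>\<omega> = x\<^sup>\<omega>"
    using \<open>period p\<close> iter_prefix_period[of p "x\<^sup>\<omega>"] by (simp_all add: y_def period_def)
  have "suffix (length x mod p) x\<^sup>\<omega> = suffix (length x mod p) (suffix (length x div p * p) x\<^sup>\<omega>)"
    using \<open>period p\<close> suffix_mult_period[of p "x\<^sup>\<omega>"] by (simp add: period_def)
  also have "\<dots> = x\<^sup>\<omega>"
    using period_length by (simp add: period_def)
  finally have "length y dvd length x"
    using least[of "length x mod p"] \<open>period p\<close> y_props(2) by (auto simp: period_def mod_eq_0_iff_dvd)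
  moreover have "rotate i y \<noteq> y" if "0 < i" "i < length y" for i
  proof
    assume "rotate i y = y"
    then have "suffix i y\<^sup>\<omega> = y\<^sup>\<omega>"
      using iter_subsequence_iter[of y "length y" i] rotate_eq_subsequence_iter[of y i] y_props(1) by simp
    then show False
      using least[of i] that y_props by (simp add: period_def)
  qed
  ultimately show ?thesis
    using y_props by (auto simp: primitive_def)
qed

lemma ex_lyndon_rotate:
  assumes "primitive y"
  shows "\<exists>i<length y. lyndon (rotate i y)"
proof -
  have "y \<noteq> []"
    using assms by (simp add: primitive_def)
  then obtain i where "i < length y" and least: "\<And>j. j < length y \<Longrightarrow> rotate i y \<le> rotate j y"
    using ex_is_arg_min_if_finite[of "{..<length y}" "\<lambda>i. rotate i y"]
    by (auto simp: is_arg_min_linorder)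
  have "rotate i y < rotate j (rotate i y)" if "0 < j" "j < length y" for j
  proof -
    have "rotate j (rotate i y) = rotate ((j + i) mod length y) y"
      by (metis rotate_conv_mod rotate_rotate)
    then have "rotate i y \<le> rotate j (rotate i y)"
      using least \<open>y \<noteq> []\<close> by simp
    moreover have "rotate i (rotate j y) \<noteq> rotate i y"
      using assms that inj_fn[OF inj_rotate1, of i]
      unfolding primitive_def rotate_def by (metis injD)
    ultimately show ?thesis
      by (simp add: rotate_rotate add.commute)
  qed
  then show ?thesis
    using \<open>i < length y\<close> \<open>y \<noteq> []\<close> by (auto simp: lyndon_def)
qed

lemma ex_lyndon_root:
  fixes x :: "'a::linorder list"
  assumes "x \<noteq> []"
  shows "\<exists>z i. lyndon z \<and> length z dvd length x \<and> i < length z \<and> x = (z\<^sup>\<omega> [i \<rightarrow> i + length x])"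
proof -
  obtain y where y_root: "primitive y" "length y dvd length x" "y\<^sup>\<omega> = x\<^sup>\<omega>"
    using ex_primitive_root[OF assms] by blast
  have "y \<noteq> []"
    using y_root(1) by (simp add: primitive_def)
  obtain a where a_rotates: "a < length y" "lyndon (rotate a y)"
    using ex_lyndon_rotate[OF y_root(1)] by blast
  define z where "z = rotate a y"
  define i where "i = (length y - a) mod length z"
  have "z \<noteq> []" "length z = length y"
    using \<open>y \<noteq> []\<close> by (simp_all add: z_def)
  have "z\<^sup>\<omega> = suffix a y\<^sup>\<omega>"
    using iter_subsequence_iter[of y "length y" a] \<open>y \<noteq> []\<close>
    by (simp add: z_def rotate_eq_subsequence_iter)
  have "z\<^sup>\<omega> [i \<rightarrow> i + length x] = (z\<^sup>\<omega> [length y - a \<rightarrow> length y - a + length x])"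
    by (rule subsequence_iter_cong[OF \<open>z \<noteq> []\<close>]) (simp add: i_def)
  also have "\<dots> = (y\<^sup>\<omega> [length y \<rightarrow> length y + length x])"
    using a_rotates(1) by (simp add: \<open>z\<^sup>\<omega> = suffix a y\<^sup>\<omega>\<close>)
  also have "\<dots> = x"
    using subsequence_iter_cong[OF \<open>y \<noteq> []\<close>, of "length y" 0 "length x"] y_root(3) prefix_iter[OF assms]
    by simp
  finally have "x = (z\<^sup>\<omega> [i \<rightarrow> i + length x])" ..
  moreover have "i < length z"
    using \<open>z \<noteq> []\<close> by (simp add: i_def)
  ultimately show ?thesis
    using a_rotates(2) y_root(2) \<open>length z = length y\<close> unfolding z_def by metis
qed

section \<open>Connected multigraphs\<close>

text \<open>The edges of a multigraph are arbitrary objects \<open>e\<close> with ends \<open>s e\<close> and \<open>t e\<close>; the closure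
  \<open>equivclp\<close> forgets their orientation.\<close>

definition adjacent :: "('e \<Rightarrow> 'v) \<Rightarrow> ('e \<Rightarrow> 'v) \<Rightarrow> 'e set \<Rightarrow> 'v \<Rightarrow> 'v \<Rightarrow> bool" where
  "adjacent s t E a b \<longleftrightarrow> (\<exists>e\<in>E. a = s e \<and> b = t e)"

abbreviation linked :: "('e \<Rightarrow> 'v) \<Rightarrow> ('e \<Rightarrow> 'v) \<Rightarrow> 'e set \<Rightarrow> 'v \<Rightarrow> 'v \<Rightarrow> bool" where
  "linked s t E \<equiv> equivclp (adjacent s t E)"

lemma linked_edge: "e \<in> E \<Longrightarrow> linked s t E (s e) (t e)"
  by (rule r_into_equivclp) (auto simp: adjacent_def)

lemma equivclp_least:
  assumes "equivclp r a b" "\<And>x y. r x y \<Longrightarrow> equivclp r' x y"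
  shows "equivclp r' a b"
  using assms(1)
proof (induction rule: equivclp_induct)
  case (step y z)
  then show ?case
    using assms(2) equivclp_sym equivclp_trans by metis
qed simp

lemma equivclp_chain:
  assumes "a \<le> b" "\<And>i. a \<le> i \<Longrightarrow> i < b \<Longrightarrow> equivclp r (f i) (f (Suc i))"
  shows "equivclp r (f a) (f b)"
  using assms
proof (induction b rule: dec_induct)
  case (step n)
  then show ?case
    using equivclp_trans by (metis less_Suc_eq)
qed simp

lemma ex_edge_leaving:
  assumes "linked s t E a b" "a \<in> S" "b \<notin> S"
  shows "\<exists>e\<in>E. (s e \<in> S) \<noteq> (t e \<in> S)"
proof (rule ccontr)
  assume no_edge_leaves: "\<not> ?thesis"
  have "b \<in> S"
    using assms(1)
    by (induction rule: equivclp_induct) (use assms(2) no_edge_leaves in \<open>auto simp: adjacent_def\<close>)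
  then show False
    using assms(3) by simp
qed

definition induced_edges :: "('e \<Rightarrow> 'v) \<Rightarrow> ('e \<Rightarrow> 'v) \<Rightarrow> 'e set \<Rightarrow> 'v set \<Rightarrow> 'e set" where
  "induced_edges s t E S = {e \<in> E. s e \<in> S \<and> t e \<in> S}"

lemma ex_vertex_adding_edge:
  assumes "finite E" "s ` E \<subseteq> V" "t ` E \<subseteq> V" "linked s t E a v" "a \<in> S" "v \<notin> S"
  shows "\<exists>y\<in>V - S. card (induced_edges s t E S) < card (induced_edges s t E (insert y S))"
proof -
  obtain e where leaving: "e \<in> E" "(s e \<in> S) \<noteq> (t e \<in> S)"
    using ex_edge_leaving[OF assms(4-6)] by blast
  then obtain y where y_added: "y \<in> V - S" "e \<in> induced_edges s t E (insert y S)"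
    using assms(2,3) by (auto simp: induced_edges_def)
  then have "induced_edges s t E S \<subset> induced_edges s t E (insert y S)"
    using leaving by (auto simp: induced_edges_def)
  moreover have "finite (induced_edges s t E (insert y S))"
    using assms(1) by (simp add: induced_edges_def)
  ultimately show ?thesis
    using y_added(1) psubset_card_mono by blast
qed

lemma card_vertices_le_if_linked:
  assumes "finite V" "finite E" "s ` E \<subseteq> V" "t ` E \<subseteq> V"
    and "a \<in> V" and linked: "\<And>v. v \<in> V \<Longrightarrow> linked s t E a v"
  shows "card V \<le> card E + 1"
proof -
  define spanned where
    "spanned = {S. S \<subseteq> V \<and> a \<in> S \<and> card S \<le> card (induced_edges s t E S) + 1}"
  have "finite spanned" "{a} \<in> spanned"
    using assms(1,5) by (auto simp: spanned_def)
  then obtain S where "S \<in> spanned" and maximal: "\<And>T. T \<in> spanned \<Longrightarrow> S \<subseteq> T \<Longrightarrow> S = T"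
    using finite_has_maximal[of spanned] by auto
  then have S_spanned: "S \<subseteq> V" "a \<in> S" "card S \<le> card (induced_edges s t E S) + 1"
    by (simp_all add: spanned_def)
  have "v \<in> S" if v_mem: "v \<in> V" for v
  proof (rule ccontr)
    assume "v \<notin> S"
    then obtain y where y_new: "y \<in> V - S"
      and "card (induced_edges s t E S) < card (induced_edges s t E (insert y S))"
      using ex_vertex_adding_edge[OF assms(2-4) linked[OF v_mem] S_spanned(2) \<open>v \<notin> S\<close>] by blast
    moreover have "card (insert y S) = Suc (card S)"
      using y_new finite_subset[OF S_spanned(1) assms(1)] by simp
    ultimately have "insert y S \<in> spanned"
      using S_spanned by (simp add: spanned_def)
    then show False
      using maximal y_new by blast
  qed
  then have "S = V"
    using S_spanned(1) by blast
  moreover have "card (induced_edges s t E V) \<le> card E"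
    using assms(2) by (auto simp: induced_edges_def intro: card_mono)
  ultimately show ?thesis
    using S_spanned(3) by simp
qed

section \<open>Circuits in Rauzy graphs\<close>

definition factors :: "'a list \<Rightarrow> nat \<Rightarrow> 'a list set" where
  "factors w m = {u. sublist u w \<and> length u = m}"

lemma finite_factors: "finite (factors w m)"
  by (rule finite_subset[of _ "set (sublists w)"]) (auto simp: factors_def)

lemma butlast_image_factors: "butlast ` factors w (Suc m) \<subseteq> factors w m"
  by (auto simp: factors_def intro: sublist_order.order_trans)

lemma tl_image_factors: "tl ` factors w (Suc m) \<subseteq> factors w m"
  by (auto simp: factors_def intro: sublist_order.order_trans)

lemma card_factors_1: "card (factors w 1) = card (set w)"
proof -
  have "factors w 1 = (\<lambda>a. [a]) ` set w"
    by (fastforce simp: factors_def length_Suc_conv sublist_def dest: split_list)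
  then show ?thesis
    by (simp add: card_image inj_on_def)
qed

lemma factors_longer_eq_empty: "length w < m \<Longrightarrow> factors w m = {}"
  by (auto simp: factors_def dest: sublist_length_le)

lemma linked_factors:
  assumes "v \<in> factors w m"
  shows "linked butlast tl (factors w (Suc m)) (take m w) v"
proof -
  obtain p s where w_split: "w = p @ v @ s" and "length v = m"
    using assms by (auto simp: factors_def sublist_def)
  then have "length p + m \<le> length w"
    by simp
  define vertex where "vertex i = take m (drop i w)" for i
  have linked_Suc: "linked butlast tl (factors w (Suc m)) (vertex i) (vertex (Suc i))"
    if "i < length p" for i
  proof -
    define u where "u = take (Suc m) (drop i w)"
    have "u \<in> factors w (Suc m)"
      using that \<open>length p + m \<le> length w\<close>
      by (auto simp: u_def factors_def intro: sublist_order.order_trans)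
    moreover have "butlast u = vertex i"
      using that \<open>length p + m \<le> length w\<close> by (simp add: u_def vertex_def butlast_take)
    moreover have "tl u = vertex (Suc i)"
      by (simp add: u_def vertex_def drop_Suc tl_drop tl_take)
    ultimately show ?thesis
      by (metis linked_edge)
  qed
  have "linked butlast tl (factors w (Suc m)) (vertex 0) (vertex (length p))"
    by (rule equivclp_chain) (simp_all add: linked_Suc)
  then show ?thesis
    using w_split \<open>length v = m\<close> by (simp add: vertex_def)
qed

definition circuits :: "'a::linorder list \<Rightarrow> nat \<Rightarrow> 'a list set" where
  "circuits w m = {z. lyndon z \<and> length z \<le> m \<and>
     (\<forall>i<length z. sublist (z\<^sup>\<omega> [i \<rightarrow> i + Suc m]) w)}"

definition lyndon_edge :: "nat \<Rightarrow> 'a list \<Rightarrow> 'a list" where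
  "lyndon_edge m z = (z\<^sup>\<omega> [0 \<rightarrow> Suc m])"

lemma lyndon_edge_on_circuit:
  assumes "z \<in> circuits w m" "z' \<in> circuits w m"
    and "lyndon_edge m z' = (z\<^sup>\<omega> [i \<rightarrow> i + Suc m])" "i < length z"
  shows "length z' < length z \<or> z' = z \<and> i = 0"
proof (rule lyndon_factor_iter_cases)
  show "lyndon z" "lyndon z'"
    using assms(1,2) by (simp_all add: circuits_def)
  have "z' = take (length z') (lyndon_edge m z')"
    using assms(2) prefix_iter[of z'] by (simp add: lyndon_edge_def circuits_def lyndon_def)
  also have "\<dots> = (z\<^sup>\<omega> [i \<rightarrow> i + length z'])"
    using assms(2) by (simp add: assms(3) circuits_def)
  finally show "z' = (z\<^sup>\<omega> [i \<rightarrow> i + length z'])" .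
qed (rule assms(4))

lemma inj_on_lyndon_edge: "inj_on (lyndon_edge m) (circuits w m)"
proof (rule inj_onI)
  fix z z'
  assume same_edge: "z \<in> circuits w m" "z' \<in> circuits w m" "lyndon_edge m z = lyndon_edge m z'"
  moreover have "z \<noteq> []" "z' \<noteq> []"
    using same_edge by (simp_all add: circuits_def lyndon_def)
  ultimately show "z = z'"
    using lyndon_edge_on_circuit[of z w m z' 0] lyndon_edge_on_circuit[of z' w m z 0]
    by (auto simp: lyndon_edge_def)
qed

lemma lyndon_edge_image_circuits: "lyndon_edge m ` circuits w m \<subseteq> factors w (Suc m)"
  by (force simp: lyndon_edge_def circuits_def factors_def lyndon_def)

lemma finite_circuits: "finite (circuits w m)"
  using inj_on_finite[OF inj_on_lyndon_edge lyndon_edge_image_circuits finite_factors] .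

definition reduced_edges :: "'a::linorder list \<Rightarrow> nat \<Rightarrow> 'a list set" where
  "reduced_edges w m = factors w (Suc m) - lyndon_edge m ` circuits w m"

text \<open>By induction on \<open>|z|\<close>: the other edges of the circuit of \<open>z\<close> can only be Lyndon edges of shorter
  circuits, hence the rest of the circuit still joins the ends of its Lyndon edge.\<close>

lemma linked_lyndon_edge:
  assumes "z \<in> circuits w m"
  shows "linked butlast tl (reduced_edges w m) (butlast (lyndon_edge m z)) (tl (lyndon_edge m z))"
  using assms
proof (induction "length z" arbitrary: z rule: less_induct)
  case less
  define vertex where "vertex i = (z\<^sup>\<omega> [i \<rightarrow> i + m])" for i
  have "z \<noteq> []"
    using less.prems by (simp add: circuits_def lyndon_def)
  have linked_Suc: "linked butlast tl (reduced_edges w m) (vertex i) (vertex (Suc i))"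
    if "0 < i" "i < length z" for i
  proof -
    define u where "u = (z\<^sup>\<omega> [i \<rightarrow> i + Suc m])"
    have u_edge: "u \<in> factors w (Suc m)" "butlast u = vertex i" "tl u = vertex (Suc i)"
      using that less.prems
      by (auto simp: u_def vertex_def circuits_def factors_def butlast_subsequence tl_subsequence)
    show ?thesis
    proof (cases "u \<in> reduced_edges w m")
      case True
      then show ?thesis
        using linked_edge[of u _ butlast tl] u_edge by simp
    next
      case False
      then obtain z' where z'_edge: "z' \<in> circuits w m" "u = lyndon_edge m z'"
        using u_edge(1) by (auto simp: reduced_edges_def)
      then have "length z' < length z"
        using lyndon_edge_on_circuit[OF less.prems z'_edge(1), of i] that by (simp add: u_def)
      then show ?thesis
        using less.hyps z'_edge u_edge by metis
    qed
  qed
  have "linked butlast tl (reduced_edges w m) (vertex 1) (vertex (length z))"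
    by (rule equivclp_chain) (use \<open>z \<noteq> []\<close> in \<open>simp_all add: linked_Suc Suc_le_eq\<close>)
  moreover have "vertex (length z) = vertex 0"
    unfolding vertex_def by (rule subsequence_iter_cong[OF \<open>z \<noteq> []\<close>]) simp
  moreover have "butlast (lyndon_edge m z) = vertex 0" "tl (lyndon_edge m z) = vertex 1"
    by (simp_all add: lyndon_edge_def vertex_def butlast_subsequence tl_subsequence)
  ultimately show ?case
    using equivclp_sym by metis
qed

lemma linked_reduced_edges:
  assumes "v \<in> factors w m"
  shows "linked butlast tl (reduced_edges w m) (take m w) v"
  using linked_factors[OF assms]
proof (rule equivclp_least)
  fix x y assume "adjacent butlast tl (factors w (Suc m)) x y"
  then obtain u where u_edge: "u \<in> factors w (Suc m)" "x = butlast u" "y = tl u"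
    by (auto simp: adjacent_def)
  show "linked butlast tl (reduced_edges w m) x y"
  proof (cases "u \<in> reduced_edges w m")
    case True
    then show ?thesis
      unfolding u_edge(2,3) by (rule linked_edge)
  next
    case False
    then show ?thesis
      using u_edge linked_lyndon_edge by (auto simp: reduced_edges_def)
  qed
qed

lemma card_reduced_edges:
  "card (reduced_edges w m) + card (circuits w m) = card (factors w (Suc m))"
proof -
  have "card (reduced_edges w m) + card (lyndon_edge m ` circuits w m) = card (factors w (Suc m))"
    unfolding reduced_edges_def
    using card_mono[OF finite_factors lyndon_edge_image_circuits[of m w]]
    by (simp add: card_Diff_subset lyndon_edge_image_circuits finite_circuits)
  then show ?thesis
    by (simp add: card_image[OF inj_on_lyndon_edge])
qed

lemma card_factors_add_card_circuits_le:
  assumes "m \<le> length w"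
  shows "card (factors w m) + card (circuits w m) \<le> card (factors w (Suc m)) + 1"
proof -
  have "card (factors w m) \<le> card (reduced_edges w m) + 1"
  proof (rule card_vertices_le_if_linked)
    show "butlast ` reduced_edges w m \<subseteq> factors w m" "tl ` reduced_edges w m \<subseteq> factors w m"
      using butlast_image_factors[of w m] tl_image_factors[of w m] by (auto simp: reduced_edges_def)
    show "take m w \<in> factors w m"
      using assms by (simp add: factors_def)
    show "finite (reduced_edges w m)"
      by (simp add: reduced_edges_def finite_factors)
  qed (simp_all add: finite_factors linked_reduced_edges)
  then show ?thesis
    using card_reduced_edges[of w m] by linarith
qed

lemma card_set_add_sum_card_circuits_le:
  "card (set w) + (\<Sum>m=1..length w. card (circuits w m)) \<le> length w"
proof -
  have "card (factors w 1) + (\<Sum>m=1..n. card (circuits w m)) \<le> card (factors w (Suc n)) + n"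
    if "n \<le> length w" for n
    using that
  proof (induction n)
    case (Suc n)
    then show ?case
      using card_factors_add_card_circuits_le[of "Suc n" w] by simp
  qed simp
  from this[of "length w"] show ?thesis
    unfolding card_factors_1 by (simp add: factors_longer_eq_empty)
qed

section \<open>Counting powers\<close>

definition occurring_shifts :: "'a list \<Rightarrow> 'a list \<Rightarrow> nat \<Rightarrow> nat set" where
  "occurring_shifts w z l = {i. i < length z \<and> sublist (z\<^sup>\<omega> [i \<rightarrow> i + l]) w}"

lemma occurring_shifts_subset: "occurring_shifts w z l \<subseteq> {..<length z}"
  by (auto simp: occurring_shifts_def)

lemma finite_occurring_shifts: "finite (occurring_shifts w z l)"
  by (rule finite_subset[OF occurring_shifts_subset finite_lessThan])

lemma card_occurring_shifts_le: "card (occurring_shifts w z l) \<le> length z"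
  using card_mono[OF _ occurring_shifts_subset, of z w l] by simp

lemma occurring_shifts_nonempty_length: "occurring_shifts w z l \<noteq> {} \<Longrightarrow> l \<le> length w"
  using sublist_length_le by (fastforce simp: occurring_shifts_def)

lemma occurring_shifts_Suc_subset: "occurring_shifts w z (Suc l) \<subseteq> occurring_shifts w z l"
proof
  fix i assume "i \<in> occurring_shifts w z (Suc l)"
  moreover have "sublist (z\<^sup>\<omega> [i \<rightarrow> i + l]) (z\<^sup>\<omega> [i \<rightarrow> i + Suc l])"
    by (rule sublist_subsequence) simp_all
  ultimately show "i \<in> occurring_shifts w z l"
    unfolding occurring_shifts_def mem_Collect_eq using sublist_order.order_trans by blast
qed

lemma Suc_mod_mem_occurring_shifts:
  assumes "i \<in> occurring_shifts w z (Suc l)"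
  shows "Suc i mod length z \<in> occurring_shifts w z l"
proof -
  define i' where "i' = Suc i mod length z"
  have "z \<noteq> []" and occurs: "sublist (z\<^sup>\<omega> [i \<rightarrow> i + Suc l]) w"
    using assms by (auto simp: occurring_shifts_def)
  have "z\<^sup>\<omega> [i' \<rightarrow> i' + l] = (z\<^sup>\<omega> [Suc i \<rightarrow> Suc i + l])"
    by (rule subsequence_iter_cong[OF \<open>z \<noteq> []\<close>]) (simp add: i'_def)
  moreover have "sublist (z\<^sup>\<omega> [Suc i \<rightarrow> Suc i + l]) (z\<^sup>\<omega> [i \<rightarrow> i + Suc l])"
    by (rule sublist_subsequence) simp_all
  ultimately have "sublist (z\<^sup>\<omega> [i' \<rightarrow> i' + l]) w"
    using occurs by (metis sublist_order.order_trans)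
  moreover have "i' < length z"
    using \<open>z \<noteq> []\<close> by (simp add: i'_def)
  ultimately show ?thesis
    unfolding i'_def[symmetric] by (simp add: occurring_shifts_def)
qed

lemma residues_eq_if_Suc_closed:
  fixes A :: "nat set"
  assumes "A \<subseteq> {..<p}" "A \<noteq> {}" and closed: "\<And>a. a \<in> A \<Longrightarrow> Suc a mod p \<in> A"
  shows "A = {..<p}"
proof -
  obtain a where "a \<in> A" "a < p"
    using assms(1,2) by blast
  have shifted: "(a + s) mod p \<in> A" for s
  proof (induction s)
    case (Suc s)
    then show ?case
      using closed[of "(a + s) mod p"] by (simp add: mod_Suc_eq)
  qed (use \<open>a \<in> A\<close> \<open>a < p\<close> in simp)
  have "i \<in> A" if "i < p" for i
    using shifted[of "p - a + i"] \<open>a < p\<close> that by simp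
  then show ?thesis
    using assms(1) by blast
qed

lemma card_occurring_shifts_Suc_less:
  assumes "occurring_shifts w z (Suc l) \<noteq> {}" "occurring_shifts w z l \<noteq> {..<length z}"
  shows "card (occurring_shifts w z (Suc l)) < card (occurring_shifts w z l)"
proof (rule psubset_card_mono[OF finite_occurring_shifts])
  have "occurring_shifts w z (Suc l) \<noteq> occurring_shifts w z l"
    using residues_eq_if_Suc_closed[OF occurring_shifts_subset[of w z l]]
      Suc_mod_mem_occurring_shifts[of _ w z l] assms by metis
  then show "occurring_shifts w z (Suc l) \<subset> occurring_shifts w z l"
    using occurring_shifts_Suc_subset by blast
qed

lemma occurring_shifts_eq_lessThan:
  assumes "occurring_shifts w z (l + t) \<noteq> {}"
    and "length z \<le> card (occurring_shifts w z (l + t)) + t"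
  shows "occurring_shifts w z l = {..<length z}"
  using assms
proof (induction t)
  case 0
  then have "card (occurring_shifts w z l) = card {..<length z}"
    using card_occurring_shifts_le[of w z l] by simp
  then show ?case
    by (rule card_subset_eq[OF finite_lessThan occurring_shifts_subset])
next
  case (Suc t)
  have "occurring_shifts w z (l + t) \<noteq> {}"
    using Suc.prems(1) occurring_shifts_Suc_subset[of w z "l + t"] by auto
  moreover have "length z \<le> card (occurring_shifts w z (l + t)) + t"
    using Suc.prems card_occurring_shifts_Suc_less[of w z "l + t"] by fastforce
  ultimately show ?case
    by (rule Suc.IH)
qed

lemma mem_circuits_if_occurring_shifts:
  assumes "lyndon z" "occurring_shifts w z l \<noteq> {}" "length z \<le> m" "Suc m \<le> l"
    and "length z + Suc m \<le> card (occurring_shifts w z l) + l"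
  shows "z \<in> circuits w m"
proof -
  obtain t where "l = Suc m + t"
    using assms(4) le_Suc_ex by blast
  then have "occurring_shifts w z (Suc m) = {..<length z}"
    using occurring_shifts_eq_lessThan[of w z "Suc m" t] assms(2,5) by simp
  then show ?thesis
    using assms(1,3) by (auto simp: circuits_def occurring_shifts_def)
qed

lemma circuit_orders_superset:
  assumes "lyndon z" and occurs: "occurring_shifts w z (k * Suc j * length z) \<noteq> {}"
  shows "{k * j * length z + length z..<k * Suc j * length z
      + card (occurring_shifts w z (k * Suc j * length z)) - length z}
    \<subseteq> {m \<in> {1..length w}. z \<in> circuits w m \<and> m div (k * length z) = j}"
proof
  define p where "p = length z"
  define l where "l = k * Suc j * p"
  define c where "c = card (occurring_shifts w z l)"
  have "0 < p" "c \<le> p"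
    using lyndon_nonempty[OF assms(1)] card_occurring_shifts_le by (simp_all add: p_def c_def)
  fix m
  assume "m \<in> {k * j * length z + length z..<k * Suc j * length z
    + card (occurring_shifts w z (k * Suc j * length z)) - length z}"
  then have m_bounds: "k * j * p + p \<le> m" "m < l + c - p"
    by (simp_all add: p_def l_def c_def)
  then have "Suc m \<le> l" "p + Suc m \<le> c + l"
    using \<open>c \<le> p\<close> by linarith+
  then have "z \<in> circuits w m"
    using mem_circuits_if_occurring_shifts[OF assms] m_bounds(1) by (simp add: p_def c_def l_def)
  moreover have "m div (k * p) = j"
    using m_bounds(1) \<open>Suc m \<le> l\<close> by (intro div_nat_eqI) (simp_all add: l_def algebra_simps)
  moreover have "l \<le> length w"
    using occurring_shifts_nonempty_length[OF occurs] by (simp add: l_def p_def)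
  then have "m \<in> {1..length w}"
    using m_bounds(1) \<open>Suc m \<le> l\<close> \<open>0 < p\<close> by simp
  ultimately show "m \<in> {m \<in> {1..length w}. z \<in> circuits w m \<and> m div (k * length z) = j}"
    by (simp add: p_def)
qed

lemma card_occurring_shifts_le_card_orders:
  assumes "lyndon z"
  shows "(k - 1) * card (occurring_shifts w z (k * Suc j * length z))
    \<le> card {m \<in> {1..length w}. z \<in> circuits w m \<and> m div (k * length z) = j}"
proof (cases "(k - 1) * card (occurring_shifts w z (k * Suc j * length z)) = 0")
  case True
  then show ?thesis
    by (simp only: le0)
next
  case False
  define p where "p = length z"
  define c where "c = card (occurring_shifts w z (k * Suc j * p))"
  obtain d where k_eq: "k = Suc (Suc d)"
    using less_imp_Suc_add[of 1 k] False by auto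
  have "c \<le> p"
    using card_occurring_shifts_le by (simp add: p_def c_def)
  then have "(k - 1) * c \<le> d * p + c"
    by (simp add: k_eq)
  also have "\<dots> = card {k * j * p + p..<k * Suc j * p + c - p}"
    by (simp add: k_eq algebra_simps)
  also have "\<dots> \<le> card {m \<in> {1..length w}. z \<in> circuits w m \<and> m div (k * p) = j}"
    unfolding p_def c_def by (intro card_mono circuit_orders_superset[OF assms]) (use False in auto)
  finally show ?thesis
    by (simp only: c_def p_def)
qed

lemma sum_card_fibres_le:
  assumes "finite A" "finite J"
  shows "(\<Sum>j\<in>J. card {a \<in> A. f a = j}) \<le> card A"
proof -
  have "(\<Sum>j\<in>J. card {a \<in> A. f a = j}) = card (\<Union>j\<in>J. {a \<in> A. f a = j})"
    using assms by (subst card_UN_disjoint) auto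
  also have "\<dots> \<le> card A"
    using assms(1) by (intro card_mono) auto
  finally show ?thesis .
qed

lemma sum_card_occurring_shifts_le:
  assumes "lyndon z" "finite J"
  shows "(k - 1) * (\<Sum>j\<in>J. card (occurring_shifts w z (k * Suc j * length z)))
    \<le> card {m \<in> {1..length w}. z \<in> circuits w m}"
proof -
  define orders where "orders = {m \<in> {1..length w}. z \<in> circuits w m}"
  have "(k - 1) * (\<Sum>j\<in>J. card (occurring_shifts w z (k * Suc j * length z)))
      \<le> (\<Sum>j\<in>J. card {m \<in> orders. m div (k * length z) = j})"
    unfolding sum_distrib_left using card_occurring_shifts_le_card_orders[OF assms(1), of k w]
    by (intro sum_mono) (simp add: orders_def)
  also have "\<dots> \<le> card orders"
    by (rule sum_card_fibres_le) (simp_all add: orders_def assms(2))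
  finally show ?thesis
    unfolding orders_def .
qed

lemma kpower_factor_lyndon_root:
  fixes w :: "'a::linorder list"
  assumes "u \<in> kpower_factors k w"
  obtains z j i where "lyndon z" "i \<in> occurring_shifts w z (k * Suc j * length z)"
    "u = (z\<^sup>\<omega> [i \<rightarrow> i + k * Suc j * length z])"
proof -
  obtain x where x_power: "sublist u w" "x \<noteq> []" "u = concat (replicate k x)"
    using assms by (auto simp: kpower_factors_def is_kpower_def)
  obtain z i where z_root: "lyndon z" "length z dvd length x" "i < length z"
    and x_eq: "x = (z\<^sup>\<omega> [i \<rightarrow> i + length x])"
    using ex_lyndon_root[OF x_power(2)] by blast
  obtain j where length_x: "length x = Suc j * length z"
    using z_root(2) x_power(2) by (metis dvdE length_0_conv mult.commute mult_0 not0_implies_Suc)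
  have "u = concat (replicate k (z\<^sup>\<omega> [i \<rightarrow> i + length x]))"
    using x_power(3) x_eq by simp
  also have "\<dots> = (z\<^sup>\<omega> [i \<rightarrow> i + k * length x])"
    using z_root(1,2) x_power(2) by (intro concat_replicate_subsequence_iter) (auto simp: lyndon_nonempty)
  finally have u_eq: "u = (z\<^sup>\<omega> [i \<rightarrow> i + k * Suc j * length z])"
    by (simp only: length_x mult.assoc)
  then have "i \<in> occurring_shifts w z (k * Suc j * length z)"
    using z_root(3) x_power(1) by (simp add: occurring_shifts_def)
  then show thesis
    using that z_root(1) u_eq by blast
qed

definition circuit_words :: "'a::linorder list \<Rightarrow> 'a list set" where
  "circuit_words w = (\<Union>m\<in>{1..length w}. circuits w m)"

lemma finite_circuit_words: "finite (circuit_words w)"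
  by (simp add: circuit_words_def finite_circuits)

lemma lyndon_circuit_words: "z \<in> circuit_words w \<Longrightarrow> lyndon z"
  by (auto simp: circuit_words_def circuits_def)

lemma mem_circuit_words_if_occurring_shifts:
  assumes "1 < k" "lyndon z" "occurring_shifts w z (k * Suc j * length z) \<noteq> {}"
  shows "z \<in> circuit_words w"
proof -
  have "0 < (k - 1) * card (occurring_shifts w z (k * Suc j * length z))"
    using assms by (simp add: card_gt_0_iff finite_occurring_shifts)
  also have "\<dots> \<le> card {m \<in> {1..length w}. z \<in> circuits w m \<and> m div (k * length z) = j}"
    by (rule card_occurring_shifts_le_card_orders[OF assms(2)])
  finally show ?thesis
    by (auto simp: circuit_words_def card_gt_0_iff)
qed

lemma kpower_factor_circuit_word:
  fixes w :: "'a::linorder list"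
  assumes "1 < k" "u \<in> kpower_factors k w"
  obtains z j i where "z \<in> circuit_words w" "j < length w"
    "i \<in> occurring_shifts w z (k * Suc j * length z)"
    "u = (z\<^sup>\<omega> [i \<rightarrow> i + k * Suc j * length z])"
proof -
  obtain z j i where "lyndon z" and occurs: "i \<in> occurring_shifts w z (k * Suc j * length z)"
    and u_eq: "u = (z\<^sup>\<omega> [i \<rightarrow> i + k * Suc j * length z])"
    using assms(2) by (rule kpower_factor_lyndon_root)
  have "z \<in> circuit_words w"
    using mem_circuit_words_if_occurring_shifts[OF assms(1) \<open>lyndon z\<close>] occurs by blast
  have "1 \<le> k * length z"
    using assms(1) lyndon_nonempty[OF \<open>lyndon z\<close>] by (simp add: Suc_le_eq)
  then have "Suc j * 1 \<le> Suc j * (k * length z)"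
    by (rule mult_le_mono2)
  also have "\<dots> = k * Suc j * length z"
    by (simp only: mult.left_commute mult.assoc)
  also have "\<dots> \<le> length w"
    using occurring_shifts_nonempty_length occurs by blast
  finally have "j < length w"
    by simp
  show thesis
    by (rule that[OF \<open>z \<in> circuit_words w\<close> \<open>j < length w\<close> occurs u_eq])
qed

lemma num_kpowers_le_sum_card_occurring_shifts:
  fixes w :: "'a::linorder list"
  assumes "1 < k"
  shows "num_kpowers k w
    \<le> (\<Sum>z\<in>circuit_words w. \<Sum>j<length w. card (occurring_shifts w z (k * Suc j * length z)))"
proof -
  define power where "power = (\<lambda>(z :: 'a list, j, i). (z\<^sup>\<omega> [i \<rightarrow> i + k * Suc j * length z]))"
  define triples where "triples =
    (SIGMA z:circuit_words w. SIGMA j:{..<length w}. occurring_shifts w z (k * Suc j * length z))"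
  have "kpower_factors k w \<subseteq> power ` triples"
  proof
    fix u assume "u \<in> kpower_factors k w"
    with assms obtain z j i where "z \<in> circuit_words w" "j < length w"
      "i \<in> occurring_shifts w z (k * Suc j * length z)"
      and u_eq: "u = (z\<^sup>\<omega> [i \<rightarrow> i + k * Suc j * length z])"
      by (rule kpower_factor_circuit_word)
    then have "(z, j, i) \<in> triples"
      by (simp add: triples_def)
    moreover have "u = power (z, j, i)"
      by (simp add: u_eq power_def)
    ultimately show "u \<in> power ` triples"
      by blast
  qed
  moreover have "finite triples"
    by (auto simp: triples_def finite_circuit_words finite_occurring_shifts)
  ultimately have "num_kpowers k w \<le> card triples"
    unfolding num_kpowers_def by (rule surj_card_le[rotated])
  then show ?thesis
    by (simp add: triples_def finite_circuit_words finite_occurring_shifts)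
qed

lemma num_kpowers_le_sum_card_circuits:
  assumes "1 < k"
  shows "(k - 1) * num_kpowers k w \<le> (\<Sum>m=1..length w. card (circuits w m))"
proof -
  have "(k - 1) * num_kpowers k w \<le> (\<Sum>z\<in>circuit_words w.
      (k - 1) * (\<Sum>j<length w. card (occurring_shifts w z (k * Suc j * length z))))"
    unfolding sum_distrib_left[symmetric]
    by (rule mult_le_mono2[OF num_kpowers_le_sum_card_occurring_shifts[OF assms]])
  also have "\<dots> \<le> (\<Sum>z\<in>circuit_words w. card {m \<in> {1..length w}. z \<in> circuits w m})"
    by (intro sum_mono sum_card_occurring_shifts_le) (simp_all add: lyndon_circuit_words)
  also have "\<dots> = (\<Sum>m=1..length w. card {z \<in> circuit_words w. z \<in> circuits w m})"
    by (rule sum_multicount_gen) (simp_all add: finite_circuit_words)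
  also have "\<dots> = (\<Sum>m=1..length w. card (circuits w m))"
    by (intro sum.cong arg_cong[of _ _ card]) (auto simp: circuit_words_def)
  finally show ?thesis .
qed

lemma num_kpowers_add_card_set_le:
  fixes w :: "'a list"
  assumes "k > 1"
  shows "(k - 1) * num_kpowers k w + card (set w) \<le> length w"
proof -
  obtain f :: "'a \<Rightarrow> nat" where inj_f: "inj_on f (set w)"
    using finite_imp_inj_to_nat_seg[of "set w"] by auto
  have "(k - 1) * num_kpowers k w \<le> (k - 1) * num_kpowers k (map f w)"
    using num_kpowers_map_inj[OF inj_f] by simp
  moreover have "(k - 1) * num_kpowers k (map f w)
      \<le> (\<Sum>m=1..length (map f w). card (circuits (map f w) m))"
    by (rule num_kpowers_le_sum_card_circuits[OF assms])
  moreover have "card (set (map f w)) = card (set w)"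
    using inj_f by (simp add: card_image)
  moreover have "card (set (map f w)) + (\<Sum>m=1..length (map f w). card (circuits (map f w) m))
      \<le> length (map f w)"
    by (rule card_set_add_sum_card_circuits_le)
  ultimately show ?thesis
    by (metis (no_types, lifting) length_map add_le_mono le_trans add.commute order_refl)
qed

lemma num_kpowers_le:
  assumes "k > 1"
  shows "real (num_kpowers k w) \<le> (real (length w) - real (card (set w))) / (real k - 1)"
proof -
  have "real ((k - 1) * num_kpowers k w + card (set w)) \<le> real (length w)"
    using num_kpowers_add_card_set_le[OF assms, of w] by (rule of_nat_mono)
  then show ?thesis
    using assms by (simp add: field_simps)
qed

lemma max_num_kpowers_attained:
  obtains w :: "'a list" where "length w = n" "max_num_kpowers TYPE('a) n k = num_kpowers k w"
proof -
  have "max_num_kpowers TYPE('a) n k \<in> {num_kpowers k w | w :: 'a list. length w = n}"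
    unfolding max_num_kpowers_def
    by (rule Max_in[OF finite_num_kpowers_values num_kpowers_values_nonempty])
  then show thesis
    using that by blast
qed

lemma max_num_kpowers_le:
  assumes "k > 1" "n \<ge> 1"
  shows "real (max_num_kpowers TYPE('a) n k) \<le> (real n - 1) / (real k - 1)"
proof -
  obtain w :: "'a list" where w_max: "length w = n" "max_num_kpowers TYPE('a) n k = num_kpowers k w"
    by (rule max_num_kpowers_attained)
  have "1 \<le> card (set w)"
    using w_max(1) assms(2) by (cases w) (auto simp: Suc_le_eq card_gt_0_iff)
  have "real (max_num_kpowers TYPE('a) n k) \<le> (real n - real (card (set w))) / (real k - 1)"
    using num_kpowers_le[OF assms(1), of w] by (simp add: w_max)
  also have "\<dots> \<le> (real n - 1) / (real k - 1)"
    using assms(1) \<open>1 \<le> card (set w)\<close> by (intro divide_right_mono) simp_all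
  finally show ?thesis .
qed

theorem mainTheorem2:
  fixes k :: nat
  assumes "k > 1"
  shows "(\<forall>w :: 'a list. real (num_kpowers k w)
            \<le> (real (length w) - real (card (set w))) / (real k - 1))
       \<and> (\<forall>n\<ge>1. real (max_num_kpowers TYPE('b) n k) \<le> (real n - 1) / (real k - 1))"
  using num_kpowers_le[OF assms] max_num_kpowers_le[OF assms] by blast

end
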